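(* Let $n\ge 2$ and $y\in\mathbb{R}^n$, and run LARS on the reparametrized fused lasso system $(\tilde y,\tilde X)$, with knots $\lambda_1>\lambda_2>\cdots$, entering indices $j_1,j_2,\dots$ and entering signs $s_1,s_2,\dots$. Assume generic position: at each step $k$ the maximizer of $|\tilde X_j^\top\tilde r^{(k-1)}|$ over inactive $j$ is unique. Then, at step $k$, the lower truncation endpoint $\lambda_{k+1}^+$ satisfies $$\lambda_{k+1}^+=\lambda_{k+1}.$$ Consequently, the selection event (at step $k$) can be written with a single lower bound: $$\tilde c_1(j_1,s_1)^\top\tilde y\ \ge\ \cdots\ \ge\ \tilde c_k(j_k,s_k)^\top\tilde y\ \ge\ \lambda_{k+1}.$$
   Context: **Reparametrization of the 1D fused lasso** (minimize $\frac12\|y-\mu\|_2^2+\lambda\|D\mu\|_1$ over $\mu\in\mathbb{R}^n$). $D\in\mathbb{R}^{(n-1)\times n}$ is the first-difference matrix, $(D\mu)_j=\mu_{j+1}-\mu_j$. Let $\mathbf 1_n$ be the all-ones vector, $\tilde D=\begin{bmatrix}D\\ \mathbf 1_n^\top\end{bmatrix}$ (invertible), $\tilde D^{-1}=[X_1\ X_2]$ with $X_1\in\mathbb{R}^{n\times(n-1)}$, $X_2\in\mathbb{R}^{n\times1}$, $P_2=X_2(X_2^\top X_2)^{-1}X_2^\top=\frac1n\mathbf 1_n\mathbf 1_n^\top$, $\tilde y=(I-P_2)y$, $\tilde X=(I-P_2)X_1$; $\tilde X_j$ is the $j$-th column of $\tilde X$ and $\tilde X_A$ the submatrix of columns indexed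 by $A$. **LARS for $(\tilde y,\tilde X)$.** Start with $\mathcal M_0=\emptyset$, residual $\tilde y$, $\lambda_0=+\infty$. Put $\lambda_1=\max_j|\tilde X_j^\top\tilde y|$, $j_1$ a maximizer, $s_1=\mathrm{sign}(\tilde X_{j_1}^\top\tilde y)$, $\mathcal M_1=\{j_1\}$. For $k\ge2$, with $A=\mathcal M_{k-1}$ and $s_A=(s_1,\dots,s_{k-1})^\top$, for $\lambda\le\lambda_{k-1}$ the residual is $\tilde r(\lambda)=\tilde y-\tilde X_A(\tilde X_A^\top\tilde X_A)^{-1}(\tilde X_A^\top\tilde y-\lambda s_A)$. The knot $\lambda_k$ is the largest $\lambda<\lambda_{k-1}$ at which some $j\notin A$ attains $|\tilde X_j^\top\tilde r(\lambda)|=\lambda$; $j_k$ is such an index, $s_k=\mathrm{sign}(\tilde X_{j_k}^\top\tilde r(\lambda_k))$, $\mathcal M_k=A\cup\{j_k\}$. Here $\tilde r^{(k-1)}=\tilde r(\lambda_k)$ is the residual with active set $\mathcal M_{k-1}$ at the moment the $k$-th variable enters (for $k=1$, $\tilde r^{(0)}=\tilde y$); "inactive" means $j\notin\mathcal M_{k-1}$. The step $k$ is one for which a step $k+1$ exists. **The vectors $\tilde c_k$.** With $A=\mathcal M_{k-1}$ and $\tilde P_A=\tilde X_A(\tilde X_A^\top\tilde X_A)^{-1}\tilde X_A^\top$, for $j\notin A$ and $s\in\{-1,1\}$, $$\tilde c_k(j,s)=\frac{(I-\tilde P_A)\tilde X_j}{s-\tilde X_j^\top\tilde X_A(\tilde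 X_A^\top\tilde X_A)^{-1}s_A}$$ (for $k=1$, $A=\emptyset$ and $\tilde c_1(j,s)=\tilde X_j/s$). Pairs $(j,s)$ for which the denominator vanishes are excluded wherever $\tilde c$ is evaluated. One has $\tilde c_k(j_k,s_k)^\top\tilde y=\lambda_k$. **Competitor sets.** For each $l$, $$S_l^+=\{(j,s): j\notin\mathcal M_l,\ s\in\{-1,1\},\ \tilde c_l(j,s)^\top\tilde c_l(j_l,s_l)<\|\tilde c_l(j_l,s_l)\|_2^2,\ \tilde c_l(j,s)^\top\tilde y\le\tilde c_l(j_l,s_l)^\top\tilde y\},$$ $$S_l^-=\{(j,s): j\notin\mathcal M_l,\ s\in\{-1,1\},\ \tilde c_l(j,s)^\top\tilde c_l(j_l,s_l)>\|\tilde c_l(j_l,s_l)\|_2^2,\ \tilde c_l(j,s)^\top\tilde y\le\tilde c_l(j_l,s_l)^\top\tilde y\}.$$ **Lower truncation endpoint.** $\displaystyle\lambda_{k+1}^+:=\max_{(j,s)\in S_k^+}\tilde c_{k+1}(j,s)^\top\tilde y$. **Selection event at step $k$** ("step $k$ was reached with entrants $(j_1,s_1),\dots,(j_k,s_k)$"): the conjunction of (i) $\tilde c_1(j_1,s_1)^\top\tilde y\ge\tilde c_2(j_2,s_2)^\top\tilde y\ge\cdots\ge\tilde c_k(j_k,s_k)^\top\tilde y\ge0$; (ii) $\tilde c_k(j_k,s_k)^\top\tilde y\ge\lambda_{k+1}^+$; (iii) $\tilde c_l(j_l,s_l)^\top\tilde y\le\min_{(j,s)\in S_l^-}\tilde c_{l+1}(j,s)^\top\tilde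 y$ for $l=1,\dots,k$ (a minimum over an empty set being $+\infty$).
   Formalization: Pairs whose step-l denominator vanishes are kept in S_l^+ (with c̃_l = 0) instead of being excluded, since otherwise λ_{k+1}^+ = λ_{k+1} can fail (n=5, y=(-9,0,9,-10,10), k=3); pairs with vanishing step-(l+1) denominator are still excluded from the max and min. *)

theory Defs
  imports "HOL-Library.Extended_Real" "Jordan_Normal_Form.Gauss_Jordan_Elimination"
begin

section \<open>The reparametrized fused lasso\<close>

(* Rows, columns and vector entries are numbered from 0, so the columns of X_tilde n are
   0, ..., n - 2.  Steps of the path are numbered from 1. *)

definition minv :: "real mat \<Rightarrow> real mat" where
  "minv A = the (mat_inverse A)"

definition diff_mat :: "nat \<Rightarrow> real mat" where
  "diff_mat n = mat (n - 1) n (\<lambda>(i, c). if c = i + 1 then 1 else if c = i then -1 else 0)"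

definition D_tilde :: "nat \<Rightarrow> real mat" where
  "D_tilde n = diff_mat n @\<^sub>r mat 1 n (\<lambda>_. 1)"

definition X1 :: "nat \<Rightarrow> real mat" where
  "X1 n = mat_of_cols n (map (col (minv (D_tilde n))) [0..<n - 1])"

definition X2 :: "nat \<Rightarrow> real mat" where
  "X2 n = mat_of_cols n [col (minv (D_tilde n)) (n - 1)]"

definition col_proj :: "real mat \<Rightarrow> real mat" where
  "col_proj B = B * minv (transpose_mat B * B) * transpose_mat B"

definition y_tilde :: "nat \<Rightarrow> real vec \<Rightarrow> real vec" where
  "y_tilde n y = (1\<^sub>m n - col_proj (X2 n)) *\<^sub>v y"

definition X_tilde :: "nat \<Rightarrow> real mat" where
  "X_tilde n = (1\<^sub>m n - col_proj (X2 n)) * X1 n"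


section \<open>The LARS path\<close>

(* A path consists of the entering indices j, the entering signs s and the knots lam, all indexed
   by the step number.  The active set M_l is kept as a list in order of entry, which fixes the
   order of the columns of the active submatrix and of the entries of the sign vector. *)

definition active :: "(nat \<Rightarrow> nat) \<Rightarrow> nat \<Rightarrow> nat list" where
  "active j l = map j [1..<Suc l]"

definition inactive :: "real mat \<Rightarrow> (nat \<Rightarrow> nat) \<Rightarrow> nat \<Rightarrow> nat set" where
  "inactive X j l = {i. i < dim_col X \<and> i \<notin> set (active j l)}"

definition active_mat :: "real mat \<Rightarrow> (nat \<Rightarrow> nat) \<Rightarrow> nat \<Rightarrow> real mat" where
  "active_mat X j l = mat_of_cols (dim_row X) (map (col X) (active j l))"

definition active_signs :: "(nat \<Rightarrow> real) \<Rightarrow> nat \<Rightarrow> real vec" where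
  "active_signs s l = vec_of_list (map s [1..<Suc l])"

definition residual ::
  "real mat \<Rightarrow> real vec \<Rightarrow> (nat \<Rightarrow> nat) \<Rightarrow> (nat \<Rightarrow> real) \<Rightarrow> nat \<Rightarrow> real \<Rightarrow> real vec" where
  "residual X y j s l t =
     (let XA = active_mat X j l in
      y - XA *\<^sub>v (minv (transpose_mat XA * XA) *\<^sub>v
            (transpose_mat XA *\<^sub>v y - t \<cdot>\<^sub>v active_signs s l)))"

(* The residual with active set M_(k-1) at the moment the k-th variable enters. *)
definition entry_residual ::
  "real mat \<Rightarrow> real vec \<Rightarrow> (nat \<Rightarrow> nat) \<Rightarrow> (nat \<Rightarrow> real) \<Rightarrow> (nat \<Rightarrow> real) \<Rightarrow> nat \<Rightarrow> real vec" where
  "entry_residual X y j s lam k = (if k = 1 then y else residual X y j s (k - 1) (lam k))"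

definition knot_candidates ::
  "real mat \<Rightarrow> real vec \<Rightarrow> (nat \<Rightarrow> nat) \<Rightarrow> (nat \<Rightarrow> real) \<Rightarrow> (nat \<Rightarrow> real) \<Rightarrow> nat \<Rightarrow> real set" where
  "knot_candidates X y j s lam k =
     {t. t < lam (k - 1) \<and>
         (\<exists>i \<in> inactive X j (k - 1). \<bar>col X i \<bullet> residual X y j s (k - 1) t\<bar> = t)}"

definition lars_step ::
  "real mat \<Rightarrow> real vec \<Rightarrow> (nat \<Rightarrow> nat) \<Rightarrow> (nat \<Rightarrow> real) \<Rightarrow> (nat \<Rightarrow> real) \<Rightarrow> nat \<Rightarrow> bool" where
  "lars_step X y j s lam k \<longleftrightarrow>
     (if k = 1 then lam 1 = Max ((\<lambda>i. \<bar>col X i \<bullet> y\<bar>) ` {..<dim_col X})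
      else lam k \<in> knot_candidates X y j s lam k \<and>
           (\<forall>t \<in> knot_candidates X y j s lam k. t \<le> lam k)) \<and>
     j k \<in> inactive X j (k - 1) \<and>
     \<bar>col X (j k) \<bullet> entry_residual X y j s lam k\<bar> = lam k \<and>
     s k = sgn (col X (j k) \<bullet> entry_residual X y j s lam k)"

definition lars_run ::
  "real mat \<Rightarrow> real vec \<Rightarrow> nat \<Rightarrow> (nat \<Rightarrow> nat) \<Rightarrow> (nat \<Rightarrow> real) \<Rightarrow> (nat \<Rightarrow> real) \<Rightarrow> bool" where
  "lars_run X y K j s lam \<longleftrightarrow> (\<forall>k \<in> {1..K}. lars_step X y j s lam k)"

definition generic_position ::
  "real mat \<Rightarrow> real vec \<Rightarrow> nat \<Rightarrow> (nat \<Rightarrow> nat) \<Rightarrow> (nat \<Rightarrow> real) \<Rightarrow> (nat \<Rightarrow> real) \<Rightarrow> bool" where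
  "generic_position X y K j s lam \<longleftrightarrow>
     (\<forall>k \<in> {1..K}. \<exists>!i. is_arg_max (\<lambda>i. \<bar>col X i \<bullet> entry_residual X y j s lam k\<bar>)
                              (\<lambda>i. i \<in> inactive X j (k - 1)) i)"


section \<open>Competitors and the selection event\<close>

definition c_denom ::
  "real mat \<Rightarrow> (nat \<Rightarrow> nat) \<Rightarrow> (nat \<Rightarrow> real) \<Rightarrow> nat \<Rightarrow> nat \<Rightarrow> real \<Rightarrow> real" where
  "c_denom X j s k i \<sigma> =
     (let XA = active_mat X j (k - 1) in
      \<sigma> - col X i \<bullet> (XA *\<^sub>v (minv (transpose_mat XA * XA) *\<^sub>v active_signs s (k - 1))))"

definition c_tilde ::
  "real mat \<Rightarrow> (nat \<Rightarrow> nat) \<Rightarrow> (nat \<Rightarrow> real) \<Rightarrow> nat \<Rightarrow> nat \<Rightarrow> real \<Rightarrow> real vec" where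
  "c_tilde X j s k i \<sigma> =
     (1 / c_denom X j s k i \<sigma>) \<cdot>\<^sub>v
       ((1\<^sub>m (dim_row X) - col_proj (active_mat X j (k - 1))) *\<^sub>v col X i)"

abbreviation c_entry :: "real mat \<Rightarrow> (nat \<Rightarrow> nat) \<Rightarrow> (nat \<Rightarrow> real) \<Rightarrow> nat \<Rightarrow> real vec" where
  "c_entry X j s l \<equiv> c_tilde X j s l (j l) (s l)"

(* Convention for a vanishing denominator.  Pairs for which c_denom of step l + 1 vanishes are left
   out of the maximum and the minimum over c_tilde of step l + 1 taken below.  A pair for which
   c_denom of step l vanishes has c_tilde of step l equal to 0 (as 1 / 0 = 0), and so belongs to
   S_plus and not to S_minus (when c_entry is nonzero and its inner product with y is
   nonnegative).  Such a pair must not be dropped from S_plus: an index between two active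
   neighbours with equal signs has a vanishing denominator at step l, but, once a variable between
   them has entered with the opposite sign, it may be the very next one to enter. *)

definition S_plus ::
  "real mat \<Rightarrow> real vec \<Rightarrow> (nat \<Rightarrow> nat) \<Rightarrow> (nat \<Rightarrow> real) \<Rightarrow> nat \<Rightarrow> (nat \<times> real) set" where
  "S_plus X y j s l =
     {(i, \<sigma>). i \<in> inactive X j l \<and> \<sigma> \<in> {-1, 1} \<and>
        c_tilde X j s l i \<sigma> \<bullet> c_entry X j s l < c_entry X j s l \<bullet> c_entry X j s l \<and>
        c_tilde X j s l i \<sigma> \<bullet> y \<le> c_entry X j s l \<bullet> y}"

definition S_minus ::
  "real mat \<Rightarrow> real vec \<Rightarrow> (nat \<Rightarrow> nat) \<Rightarrow> (nat \<Rightarrow> real) \<Rightarrow> nat \<Rightarrow> (nat \<times> real) set" where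
  "S_minus X y j s l =
     {(i, \<sigma>). i \<in> inactive X j l \<and> \<sigma> \<in> {-1, 1} \<and>
        c_tilde X j s l i \<sigma> \<bullet> c_entry X j s l > c_entry X j s l \<bullet> c_entry X j s l \<and>
        c_tilde X j s l i \<sigma> \<bullet> y \<le> c_entry X j s l \<bullet> y}"

(* The lower truncation endpoint of step k + 1. *)
definition lower_endpoint ::
  "real mat \<Rightarrow> real vec \<Rightarrow> (nat \<Rightarrow> nat) \<Rightarrow> (nat \<Rightarrow> real) \<Rightarrow> nat \<Rightarrow> real" where
  "lower_endpoint X y j s k =
     Max ((\<lambda>(i, \<sigma>). c_tilde X j s (k + 1) i \<sigma> \<bullet> y) `
            {(i, \<sigma>) \<in> S_plus X y j s k. c_denom X j s (k + 1) i \<sigma> \<noteq> 0})"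

(* In the extended reals the infimum over the empty set is infinity, as required in (iii). *)
definition upper_endpoint ::
  "real mat \<Rightarrow> real vec \<Rightarrow> (nat \<Rightarrow> nat) \<Rightarrow> (nat \<Rightarrow> real) \<Rightarrow> nat \<Rightarrow> ereal" where
  "upper_endpoint X y j s l =
     (INF (i, \<sigma>) \<in> {(i, \<sigma>) \<in> S_minus X y j s l. c_denom X j s (l + 1) i \<sigma> \<noteq> 0}.
        ereal (c_tilde X j s (l + 1) i \<sigma> \<bullet> y))"

definition selection_event ::
  "real mat \<Rightarrow> real vec \<Rightarrow> (nat \<Rightarrow> nat) \<Rightarrow> (nat \<Rightarrow> real) \<Rightarrow> nat \<Rightarrow> bool" where
  "selection_event X y j s k \<longleftrightarrow>
     (\<forall>l \<in> {1..<k}. c_entry X j s l \<bullet> y \<ge> c_entry X j s (l + 1) \<bullet> y) \<and>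
     c_entry X j s k \<bullet> y \<ge> 0 \<and>
     c_entry X j s k \<bullet> y \<ge> lower_endpoint X y j s k \<and>
     (\<forall>l \<in> {1..k}. ereal (c_entry X j s l \<bullet> y) \<le> upper_endpoint X y j s l)"

end

theory Submission
  imports Defs "Jordan_Normal_Form.Determinant"
begin

text \<open>
  Write \<open>A\<close> for the active set after step \<open>k\<close>.  The correlation of a column \<open>i\<close> with the residual is
  affine in the penalty \<open>t\<close>: it equals \<open>o\<^sub>i + t * a\<^sub>i\<close>, where \<open>a\<^sub>i\<close> is the inner product of column
  \<open>i\<close> with the vector in the span of the active columns whose correlations with the active columns
  are the active signs.  The value \<open>c_tilde (k + 1) (i, \<sigma>) \<bullet> y\<close> is \<open>o\<^sub>i / (\<sigma> - a\<^sub>i)\<close>, the penalty at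
  which that correlation meets the line \<open>\<sigma> * t\<close>.

  Everything rests on one property of the fused lasso design, \<open>\<bar>a\<^sub>i\<bar> \<le> 1\<close>.  The columns are
  dual to the difference operator, so the correlations of a vector in the span of the active columns,
  padded by zeros at both ends, have vanishing second differences at the inactive positions; they
  interpolate linearly between neighbouring active signs, and a discrete maximum principle bounds
  them (\<open>fused_lasso_design\<close>).  Two consequences follow.

  \<^item> All meeting points of inactive columns lie at or below the next knot.  Since \<open>\<sigma> - a\<^sub>i\<close> has the sign of \<open>\<sigma>\<close>, the bound
    \<open>\<bar>o\<^sub>i + t * a\<^sub>i\<bar> \<le> t\<close> at the knot \<open>t\<close> gives \<open>o\<^sub>i / (\<sigma> - a\<^sub>i) \<le> t\<close> (\<open>candidate_le\<close>), and
    the entering column attains the bound.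

  \<^item> Every inactive pair with nonzero new denominator lies in \<open>S_plus\<close> and none in \<open>S_minus\<close>.
    When \<open>e\<close> enters with sign \<open>s\<close>, the slope changes by a rank-one regression update,
    \<open>a\<^sub>i' = a\<^sub>i + (s - a\<^sub>e) * K\<^sub>i\<^sub>e / K\<^sub>e\<^sub>e\<close>, with \<open>K\<close> the Gram matrix of the projected columns.
    For \<open>\<sigma> \<noteq> a\<^sub>i\<close>, the first inequality defining \<open>S_plus\<close> is
    \<open>K\<^sub>i\<^sub>e / ((\<sigma> - a\<^sub>i) * (s - a\<^sub>e)) < K\<^sub>e\<^sub>e / (s - a\<^sub>e)\<^sup>2\<close>, which says that \<open>(\<sigma> - a\<^sub>i') / (\<sigma> - a\<^sub>i)\<close> is
    positive.  By the slope bound at both steps it holds as soon as \<open>\<sigma> - a\<^sub>i'\<close> is nonzero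
    (\<open>inner_less\<close>).

  Hence the maximum in the lower endpoint runs over all inactive pairs with nonzero denominator and
  equals the next knot, while the minima in the upper endpoints run over the empty set.
\<close>


section \<open>Double orthocomplements and Gram matrices\<close>

text \<open>
  In finite dimension this is the span of \<open>C\<close>.  The orthogonal description makes membership linear,
  monotone and uniqueness arguments immediate, and it spares the bookkeeping of coefficient vectors
  when the active list grows.
\<close>
definition double_perp :: "nat \<Rightarrow> real vec set \<Rightarrow> real vec set" where
  "double_perp n C =
     {v \<in> carrier_vec n. \<forall>z \<in> carrier_vec n. (\<forall>c \<in> C. z \<bullet> c = 0) \<longrightarrow> z \<bullet> v = 0}"

lemma double_perp_carrier: "v \<in> double_perp n C \<Longrightarrow> v \<in> carrier_vec n"
  by (simp add: double_perp_def)

lemma double_perp_orth: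
  "v \<in> double_perp n C \<Longrightarrow> z \<in> carrier_vec n \<Longrightarrow> (\<And>c. c \<in> C \<Longrightarrow> z \<bullet> c = 0) \<Longrightarrow> z \<bullet> v = 0"
  by (simp add: double_perp_def)

lemma double_perp_base: "C \<subseteq> carrier_vec n \<Longrightarrow> c \<in> C \<Longrightarrow> c \<in> double_perp n C"
  by (auto simp: double_perp_def)

lemma double_perp_mono: "C \<subseteq> C' \<Longrightarrow> double_perp n C \<subseteq> double_perp n C'"
  by (auto simp: double_perp_def)

lemma double_perp_add:
  "v \<in> double_perp n C \<Longrightarrow> w \<in> double_perp n C \<Longrightarrow> v + w \<in> double_perp n C"
  by (simp add: double_perp_def scalar_prod_add_distrib[where n = n])

lemma double_perp_minus:
  "v \<in> double_perp n C \<Longrightarrow> w \<in> double_perp n C \<Longrightarrow> v - w \<in> double_perp n C"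
  by (simp add: double_perp_def scalar_prod_minus_distrib[where n = n])

lemma double_perp_smult: "v \<in> double_perp n C \<Longrightarrow> a \<cdot>\<^sub>v v \<in> double_perp n C"
  by (simp add: double_perp_def)

lemma scalar_prod_self_eq_0:
  fixes v :: "real vec"
  assumes "v \<bullet> v = 0"
  shows "v = 0\<^sub>v (dim_vec v)"
proof -
  have "(\<Sum>i \<in> {0..<dim_vec v}. v $ i * v $ i) = 0"
    using assms by (simp add: scalar_prod_def)
  then have "\<forall>i \<in> {0..<dim_vec v}. v $ i * v $ i = 0"
    by (simp add: sum_nonneg_eq_0_iff)
  then show ?thesis by (intro eq_vecI) auto
qed

lemma scalar_prod_self_nonneg: "0 \<le> v \<bullet> (v :: real vec)"
  unfolding scalar_prod_def by (intro sum_nonneg) auto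

lemma vec_eq_of_minus_eq_0:
  fixes v w :: "real vec"
  assumes v: "v \<in> carrier_vec n" and w: "w \<in> carrier_vec n" and z: "v - w = 0\<^sub>v n"
  shows "v = w"
proof (rule eq_vecI)
  show "v $ i = w $ i" if "i < dim_vec w" for i
    using arg_cong[OF z, of "\<lambda>u. u $ i"] that v w by auto
qed (use v w in auto)

text \<open>
  The difference of the two vectors lies in the span of \<open>C\<close> and is orthogonal to \<open>C\<close>, hence to
  itself.
\<close>
lemma double_perp_eqI:
  assumes v: "v \<in> double_perp n C" and w: "w \<in> double_perp n C" and C: "C \<subseteq> carrier_vec n"
    and eq: "\<And>c. c \<in> C \<Longrightarrow> c \<bullet> v = c \<bullet> w"
  shows "v = w"
proof -
  have car: "v \<in> carrier_vec n" "w \<in> carrier_vec n"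
    using v w by (auto dest: double_perp_carrier)
  have "(v - w) \<bullet> c = 0" if "c \<in> C" for c
  proof -
    have c: "c \<in> carrier_vec n" using C that by blast
    show ?thesis
      using eq[OF that] minus_scalar_prod_distrib[OF car c] comm_scalar_prod[OF c car(1)]
        comm_scalar_prod[OF c car(2)] by simp
  qed
  then have "(v - w) \<bullet> (v - w) = 0"
    using double_perp_orth[OF double_perp_minus[OF v w]] car by simp
  then have "v - w = 0\<^sub>v n"
    using scalar_prod_self_eq_0[of "v - w"] car by simp
  then show ?thesis by (rule vec_eq_of_minus_eq_0[OF car])
qed

lemma minv_inverse:
  assumes A: "A \<in> carrier_mat m m"
    and inj: "\<And>w. w \<in> carrier_vec m \<Longrightarrow> A *\<^sub>v w = 0\<^sub>v m \<Longrightarrow> w = 0\<^sub>v m"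
  shows "minv A \<in> carrier_mat m m" "A * minv A = 1\<^sub>m m"
proof -
  have "det A \<noteq> 0"
    using det_0_iff_vec_prod_zero_field[OF A] inj by auto
  then have "A \<in> Units (ring_mat TYPE(real) m ())"
    by (rule det_non_zero_imp_unit[OF A])
  then obtain B where "mat_inverse A = Some B"
    using mat_inverse(1)[OF A, where b = "()"] by (cases "mat_inverse A") auto
  then show "minv A \<in> carrier_mat m m" "A * minv A = 1\<^sub>m m"
    using mat_inverse(2)[OF A] by (auto simp: minv_def)
qed

lemma mat_mult_in_double_perp:
  assumes B: "B \<in> carrier_mat n m" and w: "w \<in> carrier_vec m"
  shows "B *\<^sub>v w \<in> double_perp n (set (cols B))"
proof -
  have "z \<bullet> (B *\<^sub>v w) = 0" if z: "z \<in> carrier_vec n" and orth: "\<forall>c \<in> set (cols B). z \<bullet> c = 0" for z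
  proof -
    have "B\<^sup>T *\<^sub>v z = 0\<^sub>v m"
    proof (rule eq_vecI)
      show "(B\<^sup>T *\<^sub>v z) $ i = 0\<^sub>v m $ i" if "i < dim_vec (0\<^sub>v m)" for i
        using that orth B z comm_scalar_prod[of z n "col B i"] by (auto simp: cols_def)
    qed (use B in auto)
    then show ?thesis
      using transpose_vec_mult_scalar[OF B w z] w by simp
  qed
  then show ?thesis
    using mult_mat_vec_carrier[OF B w] by (auto simp: double_perp_def)
qed

lemma gram_injective:
  fixes B :: "real mat"
  assumes B: "B \<in> carrier_mat n m" and w: "w \<in> carrier_vec m"
    and inj: "\<And>w. w \<in> carrier_vec m \<Longrightarrow> B *\<^sub>v w = 0\<^sub>v n \<Longrightarrow> w = 0\<^sub>v m"
    and zero: "(B\<^sup>T * B) *\<^sub>v w = 0\<^sub>v m"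
  shows "w = 0\<^sub>v m"
proof -
  have Bw: "B *\<^sub>v w \<in> carrier_vec n" using B w by simp
  have "B\<^sup>T *\<^sub>v (B *\<^sub>v w) = 0\<^sub>v m"
    using zero assoc_mult_mat_vec[of "B\<^sup>T" m n B m w] B w by simp
  then have "(B *\<^sub>v w) \<bullet> (B *\<^sub>v w) = 0"
    using transpose_vec_mult_scalar[OF B w Bw] w by simp
  then have "B *\<^sub>v w = 0\<^sub>v n"
    using scalar_prod_self_eq_0[of "B *\<^sub>v w"] B by simp
  then show ?thesis using inj w by simp
qed

text \<open>
  For independent columns, the least-squares formula produces the vector of the column span with
  prescribed inner products \<open>r\<close> with the columns.  The path uses it with the active signs as \<open>r\<close>,
  the projections with \<open>B\<^sup>T x\<close>.
\<close>
lemma gram_solution: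
  fixes B :: "real mat"
  assumes B: "B \<in> carrier_mat n m"
    and inj: "\<And>w. w \<in> carrier_vec m \<Longrightarrow> B *\<^sub>v w = 0\<^sub>v n \<Longrightarrow> w = 0\<^sub>v m"
    and r: "r \<in> carrier_vec m"
  shows "minv (B\<^sup>T * B) \<in> carrier_mat m m"
    "B *\<^sub>v (minv (B\<^sup>T * B) *\<^sub>v r) \<in> double_perp n (set (cols B))"
    "B\<^sup>T *\<^sub>v (B *\<^sub>v (minv (B\<^sup>T * B) *\<^sub>v r)) = r"
proof -
  let ?G = "B\<^sup>T * B"
  have G: "?G \<in> carrier_mat m m" using B by simp
  note inv = minv_inverse[OF G gram_injective[OF B _ inj]]
  show M: "minv ?G \<in> carrier_mat m m" using inv(1) by blast
  have e: "?G * minv ?G = 1\<^sub>m m" using inv(2) by blast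
  have w: "minv ?G *\<^sub>v r \<in> carrier_vec m" using M r by simp
  show "B *\<^sub>v (minv ?G *\<^sub>v r) \<in> double_perp n (set (cols B))"
    by (rule mat_mult_in_double_perp[OF B w])
  have "B\<^sup>T *\<^sub>v (B *\<^sub>v (minv ?G *\<^sub>v r)) = ?G *\<^sub>v (minv ?G *\<^sub>v r)"
    using assoc_mult_mat_vec[of "B\<^sup>T" m n B m "minv ?G *\<^sub>v r"] B w by simp
  also have "\<dots> = (?G * minv ?G) *\<^sub>v r"
    using assoc_mult_mat_vec[OF G M r] by simp
  finally show "B\<^sup>T *\<^sub>v (B *\<^sub>v (minv ?G *\<^sub>v r)) = r" using e r by simp
qed

lemma col_proj_apply:
  fixes B :: "real mat"
  assumes B: "B \<in> carrier_mat n m"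
    and M: "minv (B\<^sup>T * B) \<in> carrier_mat m m" and x: "x \<in> carrier_vec n"
  shows "(1\<^sub>m n - col_proj B) *\<^sub>v x = x - B *\<^sub>v (minv (B\<^sup>T * B) *\<^sub>v (B\<^sup>T *\<^sub>v x))"
proof -
  have c: "col_proj B \<in> carrier_mat n n" using B M by (simp add: col_proj_def)
  have "col_proj B *\<^sub>v x = B *\<^sub>v (minv (B\<^sup>T * B) *\<^sub>v (B\<^sup>T *\<^sub>v x))"
  proof -
    have BM: "B * minv (B\<^sup>T * B) \<in> carrier_mat n m" using B M by simp
    have Bt: "B\<^sup>T \<in> carrier_mat m n" using B by simp
    have "B\<^sup>T *\<^sub>v x \<in> carrier_vec m" using Bt x by simp
    then show ?thesis unfolding col_proj_def
      using assoc_mult_mat_vec[OF BM Bt x] assoc_mult_mat_vec[OF B M] by simp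
  qed
  then show ?thesis
    using minus_mult_distrib_mat_vec[OF one_carrier_mat c x] x by simp
qed

text \<open>
  These three facts determine the projection residual, so they can replace the matrix formula.
\<close>
lemma projection_residual:
  fixes B :: "real mat"
  assumes B: "B \<in> carrier_mat n m"
    and inj: "\<And>w. w \<in> carrier_vec m \<Longrightarrow> B *\<^sub>v w = 0\<^sub>v n \<Longrightarrow> w = 0\<^sub>v m"
    and x: "x \<in> carrier_vec n"
  shows "(1\<^sub>m n - col_proj B) *\<^sub>v x \<in> carrier_vec n"
    "x - (1\<^sub>m n - col_proj B) *\<^sub>v x \<in> double_perp n (set (cols B))"
    "\<And>c. c \<in> set (cols B) \<Longrightarrow> c \<bullet> ((1\<^sub>m n - col_proj B) *\<^sub>v x) = 0"
proof -
  have t: "B\<^sup>T *\<^sub>v x \<in> carrier_vec m" using B x by simp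
  define f where "f = B *\<^sub>v (minv (B\<^sup>T * B) *\<^sub>v (B\<^sup>T *\<^sub>v x))"
  note sol = gram_solution[OF B inj t, folded f_def]
  have q: "(1\<^sub>m n - col_proj B) *\<^sub>v x = x - f"
    unfolding f_def by (rule col_proj_apply[OF B _ x]) (use sol(1) in blast)
  have f: "f \<in> double_perp n (set (cols B))" using sol(2) by blast
  have fc: "f \<in> carrier_vec n" by (rule double_perp_carrier[OF f])
  have Bf: "B\<^sup>T *\<^sub>v f = B\<^sup>T *\<^sub>v x" using sol(3) by blast
  show "(1\<^sub>m n - col_proj B) *\<^sub>v x \<in> carrier_vec n" using q x fc by simp
  have "x - (x - f) = f" using x fc by (intro eq_vecI) auto
  then show "x - (1\<^sub>m n - col_proj B) *\<^sub>v x \<in> double_perp n (set (cols B))" using q f by simp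
  show "c \<bullet> ((1\<^sub>m n - col_proj B) *\<^sub>v x) = 0" if c: "c \<in> set (cols B)" for c
  proof -
    obtain i where i: "i < m" "c = col B i" using c B by (auto simp: cols_def)
    have "c \<bullet> f = c \<bullet> x"
      using arg_cong[OF Bf, of "\<lambda>v. v $ i"] i B by simp
    then show ?thesis
      using q scalar_prod_minus_distrib[of c n x f] i B x fc by simp
  qed
qed


section \<open>The geometry of an active set\<close>

text \<open>
  The two properties of the design that the argument uses.  The vectors in \<open>dual\<close> express linear
  independence of the columns; \<open>extrapolation\<close> says that correlations bounded by 1 on \<open>A\<close> stay
  bounded by 1 on all columns, for vectors in the span of \<open>A\<close>.
\<close>
locale lars_design =
  fixes n :: nat and X :: "real mat"
  assumes X_carrier: "X \<in> carrier_mat n (dim_col X)"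
    and dual: "c < dim_col X \<Longrightarrow>
      \<exists>z \<in> carrier_vec n. \<forall>a < dim_col X. z \<bullet> col X a = (if a = c then 1 else 0)"
    and extrapolation: "A \<subseteq> {..<dim_col X} \<Longrightarrow> v \<in> double_perp n (col X ` A) \<Longrightarrow>
      (\<forall>a \<in> A. \<bar>col X a \<bullet> v\<bar> \<le> 1) \<Longrightarrow> i < dim_col X \<Longrightarrow> \<bar>col X i \<bullet> v\<bar> \<le> 1"

locale lars_path = lars_design +
  fixes y :: "real vec" and K :: nat and j :: "nat \<Rightarrow> nat" and s lam :: "nat \<Rightarrow> real"
  assumes y_carrier: "y \<in> carrier_vec n"
    and run: "lars_run X y K j s lam"
    and generic: "generic_position X y K j s lam"
begin

lemma col_carrier: "col X i \<in> carrier_vec n"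
  using X_carrier by auto

lemma cols_carrier: "col X ` A \<subseteq> carrier_vec n"
  using col_carrier by blast

lemma step: "l < K \<Longrightarrow> lars_step X y j s lam (Suc l)"
  using run by (simp add: lars_run_def)

lemma set_active: "set (active j l) = j ` {1..l}"
  by (simp add: active_def atLeastLessThanSuc_atLeastAtMost del: upt_Suc)

lemma active_nth: "a < l \<Longrightarrow> active j l ! a = j (Suc a)"
  by (simp add: active_def del: upt_Suc)

lemma length_active: "length (active j l) = l"
  by (simp add: active_def)

lemma active_Suc: "active j (Suc l) = active j l @ [j (Suc l)]"
  by (simp add: active_def)

lemma inactive_iff: "i \<in> inactive X j l \<longleftrightarrow> i < dim_col X \<and> i \<notin> j ` {1..l}"
  by (simp add: inactive_def set_active)

lemma inactive_Suc:
  "i \<in> inactive X j (Suc l) \<longleftrightarrow> i \<in> inactive X j l \<and> i \<noteq> j (Suc l)"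
  by (auto simp: inactive_def active_Suc)

lemma entering: "l < K \<Longrightarrow> j (Suc l) \<in> inactive X j l"
  using step[of l] by (simp add: lars_step_def)

lemma active_distinct: "l \<le> K \<Longrightarrow> distinct (active j l) \<and> set (active j l) \<subseteq> {..<dim_col X}"
proof (induction l)
  case 0
  then show ?case by (simp add: active_def)
next
  case (Suc l)
  then show ?case using entering[of l] by (auto simp: active_Suc inactive_def)
qed

lemma active_subset: "l \<le> K \<Longrightarrow> j ` {1..l} \<subseteq> {..<dim_col X}"
  using active_distinct set_active by metis

lemma active_mat_carrier: "active_mat X j l \<in> carrier_mat n l"
  using X_carrier by (simp add: active_mat_def active_def mat_of_cols_def del: upt_Suc)

lemma cols_active_mat: "cols (active_mat X j l) = map (col X) (active j l)"
proof -
  have "dim_row X = n" using X_carrier by auto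
  then show ?thesis
    unfolding active_mat_def using col_carrier by (intro cols_mat_of_cols) auto
qed

lemma set_cols_active_mat: "set (cols (active_mat X j l)) = col X ` j ` {1..l}"
  by (simp add: cols_active_mat set_active)

lemma col_active_mat: "a < l \<Longrightarrow> col (active_mat X j l) a = col X (j (Suc a))"
  using cols_active_mat[of l] active_mat_carrier[of l]
  by (metis active_nth carrier_matD(2) cols_nth length_active nth_map)

lemma active_mat_inj:
  assumes l: "l \<le> K" and w: "w \<in> carrier_vec l" and zero: "active_mat X j l *\<^sub>v w = 0\<^sub>v n"
  shows "w = 0\<^sub>v l"
proof (rule eq_vecI)
  fix a assume "a < dim_vec (0\<^sub>v l)"
  then have a: "a < l" by simp
  have lt: "j (Suc b) < dim_col X" if "b < l" for b
    using active_subset[OF l] that by (auto simp: image_subset_iff)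
  obtain z where z: "z \<in> carrier_vec n"
    and dualz: "\<forall>i < dim_col X. z \<bullet> col X i = (if i = j (Suc a) then 1 else 0)"
    using dual[OF lt[OF a]] by blast
  have B: "active_mat X j l \<in> carrier_mat n l" by (rule active_mat_carrier)
  \<comment> \<open>Pairing with the dual vector of the \<open>a\<close>-th active column extracts the coefficient \<open>w $ a\<close>.\<close>
  have "(active_mat X j l)\<^sup>T *\<^sub>v z = unit_vec l a"
  proof (rule eq_vecI)
    fix b assume "b < dim_vec (unit_vec l a :: real vec)"
    then have b: "b < l" by simp
    have "j (Suc b) = j (Suc a) \<longleftrightarrow> b = a"
      using active_distinct[OF l] nth_eq_iff_index_eq[of "active j l" b a] a b
      by (simp add: active_nth length_active)
    then have "z \<bullet> col X (j (Suc b)) = unit_vec l a $ b"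
      using dualz lt[OF b] a b by simp
    then show "((active_mat X j l)\<^sup>T *\<^sub>v z) $ b = unit_vec l a $ b"
      using comm_scalar_prod[OF z col_carrier] b B col_active_mat[OF b] by simp
  qed (use B in simp)
  then have "unit_vec l a \<bullet> w = z \<bullet> (active_mat X j l *\<^sub>v w)"
    using transpose_vec_mult_scalar[OF B w z] by simp
  then show "w $ a = 0\<^sub>v l $ a"
    using zero z a w by simp
qed (use w in simp)

text \<open>
  The direction in which the residual moves as the penalty grows: the vector of the active span whose
  correlations with the active columns are the entering signs.
\<close>
definition sign_dir :: "nat \<Rightarrow> real vec" where
  "sign_dir l = (let XA = active_mat X j l in XA *\<^sub>v (minv (XA\<^sup>T * XA) *\<^sub>v active_signs s l))"

definition proj_res :: "nat \<Rightarrow> real vec \<Rightarrow> real vec" where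
  "proj_res l x = (1\<^sub>m n - col_proj (active_mat X j l)) *\<^sub>v x"

text \<open>
  The correlation of column \<open>i\<close> with the residual at penalty \<open>t\<close> is \<open>offset l i + t * slope l i\<close>
  (\<open>corr_eq\<close>).
\<close>
definition slope :: "nat \<Rightarrow> nat \<Rightarrow> real" where
  "slope l i = col X i \<bullet> sign_dir l"

definition offset :: "nat \<Rightarrow> nat \<Rightarrow> real" where
  "offset l i = col X i \<bullet> proj_res l y"

text \<open>
  Read as a covariance of the columns, this is the partial covariance given the active columns.
\<close>
definition pcov :: "nat \<Rightarrow> nat \<Rightarrow> nat \<Rightarrow> real" where
  "pcov l i i' = proj_res l (col X i) \<bullet> proj_res l (col X i')"

lemma active_signs_carrier: "active_signs s l \<in> carrier_vec l"
  by (intro carrier_vecI) (simp add: active_signs_def del: upt_Suc)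

lemma sign_dir_span:
  assumes l: "l \<le> K"
  shows "sign_dir l \<in> double_perp n (col X ` j ` {1..l})"
  using gram_solution(2)[OF active_mat_carrier active_mat_inj[OF l] active_signs_carrier]
  unfolding sign_dir_def Let_def set_cols_active_mat .

lemma sign_dir_carrier: "l \<le> K \<Longrightarrow> sign_dir l \<in> carrier_vec n"
  using double_perp_carrier[OF sign_dir_span] .

lemma slope_active:
  assumes l: "l \<le> K" and m: "m \<in> {1..l}"
  shows "slope l (j m) = s m"
proof -
  obtain a where a: "m = Suc a" "a < l" using m by (cases m) auto
  have "(active_mat X j l)\<^sup>T *\<^sub>v sign_dir l = active_signs s l"
    using gram_solution(3)[OF active_mat_carrier active_mat_inj[OF l] active_signs_carrier]
    unfolding sign_dir_def Let_def .
  then have "((active_mat X j l)\<^sup>T *\<^sub>v sign_dir l) $ a = s m"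
    using a by (simp add: active_signs_def vec_of_list_index del: upt_Suc)
  then show ?thesis
    using a active_mat_carrier[of l] by (simp add: slope_def col_active_mat)
qed

lemma proj_res:
  assumes l: "l \<le> K" and x: "x \<in> carrier_vec n"
  shows proj_res_carrier: "proj_res l x \<in> carrier_vec n"
    and proj_res_span: "x - proj_res l x \<in> double_perp n (col X ` j ` {1..l})"
    and proj_res_orth: "a \<in> j ` {1..l} \<Longrightarrow> col X a \<bullet> proj_res l x = 0"
  using projection_residual[OF active_mat_carrier active_mat_inj[OF l] x]
  unfolding proj_res_def set_cols_active_mat by blast+

lemma residual_eq:
  assumes l: "l \<le> K"
  shows "residual X y j s l t = proj_res l y + t \<cdot>\<^sub>v sign_dir l"
proof -
  let ?B = "active_mat X j l"
  let ?M = "minv (?B\<^sup>T * ?B)"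
  have B: "?B \<in> carrier_mat n l" by (rule active_mat_carrier)
  have M: "?M \<in> carrier_mat l l"
    by (rule gram_solution(1)[OF B active_mat_inj[OF l] active_signs_carrier])
  have s: "active_signs s l \<in> carrier_vec l" by (rule active_signs_carrier)
  have By: "?B\<^sup>T *\<^sub>v y \<in> carrier_vec l" using B y_carrier by simp
  have "?B *\<^sub>v (?M *\<^sub>v (?B\<^sup>T *\<^sub>v y - t \<cdot>\<^sub>v active_signs s l)) =
      ?B *\<^sub>v (?M *\<^sub>v (?B\<^sup>T *\<^sub>v y)) - t \<cdot>\<^sub>v sign_dir l"
    unfolding sign_dir_def Let_def
    using mult_minus_distrib_mat_vec[OF M By, of "t \<cdot>\<^sub>v active_signs s l"]
      mult_mat_vec[OF M s, of t]
      mult_minus_distrib_mat_vec[OF B, of "?M *\<^sub>v (?B\<^sup>T *\<^sub>v y)" "t \<cdot>\<^sub>v (?M *\<^sub>v active_signs s l)"]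
      mult_mat_vec[OF B, of "?M *\<^sub>v active_signs s l" t] M s By by simp
  then show ?thesis
    unfolding residual_def Let_def proj_res_def col_proj_apply[OF B M y_carrier]
    using B y_carrier sign_dir_carrier[OF l] by (intro eq_vecI) auto
qed

lemma corr_eq:
  assumes l: "l \<le> K"
  shows "col X i \<bullet> residual X y j s l t = offset l i + t * slope l i"
  unfolding residual_eq[OF l] offset_def slope_def
  using scalar_prod_add_distrib[OF col_carrier proj_res_carrier[OF l y_carrier], of "t \<cdot>\<^sub>v sign_dir l" i]
    sign_dir_carrier[OF l] col_carrier[of i] by simp

lemma proj_res_inner:
  assumes l: "l \<le> K" and x: "x \<in> carrier_vec n" and x': "x' \<in> carrier_vec n"
  shows "proj_res l x \<bullet> x' = proj_res l x \<bullet> proj_res l x'"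
proof -
  have "proj_res l x \<bullet> (x' - proj_res l x') = 0"
  proof (rule double_perp_orth[OF proj_res_span[OF l x'] proj_res_carrier[OF l x]])
    fix c assume "c \<in> col X ` j ` {1..l}"
    then obtain a where a: "a \<in> j ` {1..l}" "c = col X a" by blast
    show "proj_res l x \<bullet> c = 0"
      unfolding a(2) comm_scalar_prod[OF proj_res_carrier[OF l x] col_carrier]
      by (rule proj_res_orth[OF l x a(1)])
  qed
  then show ?thesis
    using scalar_prod_minus_distrib[OF proj_res_carrier[OF l x] x' proj_res_carrier[OF l x']]
    by simp
qed

lemma proj_res_inner_y: "l \<le> K \<Longrightarrow> proj_res l (col X i) \<bullet> y = offset l i"
  using proj_res_inner[OF _ col_carrier y_carrier, of l i]
    proj_res_inner[OF _ y_carrier col_carrier, of l i]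
    comm_scalar_prod[OF proj_res_carrier[OF _ col_carrier] proj_res_carrier[OF _ y_carrier], of l l i]
    comm_scalar_prod[OF col_carrier proj_res_carrier[OF _ y_carrier], of l i]
  by (simp add: offset_def)

lemma pcov_eq: "l \<le> K \<Longrightarrow> pcov l i i' = col X i \<bullet> proj_res l (col X i')"
  using proj_res_inner[OF _ col_carrier col_carrier, of l i' i]
    comm_scalar_prod[OF proj_res_carrier[OF _ col_carrier] proj_res_carrier[OF _ col_carrier], of l l i i']
    comm_scalar_prod[OF col_carrier proj_res_carrier[OF _ col_carrier], of l i i']
  by (simp add: pcov_def)

text \<open>
  A vanishing projection residual would put the inactive column into the active span, which the dual
  vector of that column excludes.
\<close>
lemma pcov_pos:
  assumes l: "l \<le> K" and i: "i \<in> inactive X j l"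
  shows "pcov l i i > 0"
proof (rule ccontr)
  let ?q = "proj_res l (col X i)"
  have q: "?q \<in> carrier_vec n" by (rule proj_res_carrier[OF l col_carrier])
  assume "\<not> pcov l i i > 0"
  then have "?q \<bullet> ?q = 0"
    unfolding pcov_def using scalar_prod_self_nonneg[of ?q] by linarith
  then have "?q = 0\<^sub>v n"
    using scalar_prod_self_eq_0[of ?q] q by simp
  then have span: "col X i \<in> double_perp n (col X ` j ` {1..l})"
    using proj_res_span[OF l col_carrier, of i] col_carrier[of i] by simp
  obtain z where z: "z \<in> carrier_vec n"
    and dualz: "\<forall>a < dim_col X. z \<bullet> col X a = (if a = i then 1 else 0)"
    using dual[of i] i by (auto simp: inactive_iff)
  have "z \<bullet> col X i = 0"
  proof (rule double_perp_orth[OF span z])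
    fix c assume "c \<in> col X ` j ` {1..l}"
    then obtain a where a: "a \<in> j ` {1..l}" "c = col X a" by blast
    then have "a < dim_col X" "a \<noteq> i"
      using active_subset[OF l] i by (auto simp: inactive_iff)
    then show "z \<bullet> c = 0" using dualz a(2) by simp
  qed
  then show False using dualz i by (simp add: inactive_iff)
qed

lemma denom_eq: "c_denom X j s (Suc l) i \<sigma> = \<sigma> - slope l i"
  by (simp add: c_denom_def slope_def sign_dir_def Let_def)

lemma c_tilde_eq:
  "c_tilde X j s (Suc l) i \<sigma> = (1 / (\<sigma> - slope l i)) \<cdot>\<^sub>v proj_res l (col X i)"
proof -
  have "dim_row X = n" using X_carrier by auto
  then show ?thesis by (simp add: c_tilde_def denom_eq proj_res_def)
qed

lemma c_tilde_inner_y: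
  assumes l: "l \<le> K"
  shows "c_tilde X j s (Suc l) i \<sigma> \<bullet> y = offset l i / (\<sigma> - slope l i)"
  using smult_scalar_prod_distrib[OF proj_res_carrier[OF l col_carrier] y_carrier]
    proj_res_inner_y[OF l] by (simp add: c_tilde_eq)

lemma c_tilde_inner:
  assumes l: "l \<le> K"
  shows "c_tilde X j s (Suc l) i \<sigma> \<bullet> c_tilde X j s (Suc l) i' \<sigma>' =
    pcov l i i' / ((\<sigma> - slope l i) * (\<sigma>' - slope l i'))"
  using proj_res_carrier[OF l col_carrier, of i] proj_res_carrier[OF l col_carrier, of i']
  by (simp add: c_tilde_eq pcov_def)

lemma sign_abs_le: "m \<in> {1..K} \<Longrightarrow> \<bar>s m\<bar> \<le> 1"
  using run by (auto simp: lars_run_def lars_step_def abs_sgn_eq)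

lemma slope_bound:
  assumes l: "l \<le> K" and i: "i < dim_col X"
  shows "\<bar>slope l i\<bar> \<le> 1"
  unfolding slope_def
proof (rule extrapolation[OF active_subset[OF l] sign_dir_span[OF l] _ i])
  show "\<forall>a \<in> j ` {1..l}. \<bar>col X a \<bullet> sign_dir l\<bar> \<le> 1"
    using slope_active[OF l] sign_abs_le l by (auto simp: slope_def)
qed

lemma slope_0: "slope 0 i = 0"
  unfolding slope_def
  by (rule double_perp_orth[OF sign_dir_span col_carrier]) auto

text \<open>
  The new direction is the old one plus a multiple of the projected entering column, which leaves the
  old correlations unchanged; the multiple is chosen to raise the correlation of the entering column
  to its sign.  Uniqueness in the new active span identifies the two.
\<close>
lemma slope_update:
  assumes l: "Suc l \<le> K"
  defines "e \<equiv> j (Suc l)"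
  shows "slope (Suc l) i = slope l i + (s (Suc l) - slope l e) / pcov l e e * pcov l i e"
proof -
  let ?b = "(s (Suc l) - slope l e) / pcov l e e"
  let ?q = "proj_res l (col X e)"
  let ?v = "sign_dir l + ?b \<cdot>\<^sub>v ?q"
  let ?C = "col X ` j ` {1..Suc l}"
  have lK: "l \<le> K" using l by simp
  have e: "e \<in> inactive X j l" unfolding e_def using entering l by simp
  have sub: "double_perp n (col X ` j ` {1..l}) \<subseteq> double_perp n ?C"
    by (intro double_perp_mono image_mono) auto
  have q: "?q \<in> carrier_vec n" by (rule proj_res_carrier[OF lK col_carrier])
  have inner: "col X a \<bullet> ?v = slope l a + ?b * pcov l a e" for a
    using scalar_prod_add_distrib[OF col_carrier sign_dir_carrier[OF lK], of "?b \<cdot>\<^sub>v ?q" a]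
      q col_carrier[of a] by (simp add: slope_def pcov_eq[OF lK])
  have "col X e - (col X e - ?q) = ?q"
    using q col_carrier[of e] by (intro eq_vecI) auto
  moreover have "col X e \<in> double_perp n ?C"
    by (rule double_perp_base[OF cols_carrier]) (auto simp: e_def)
  ultimately have "?q \<in> double_perp n ?C"
    using double_perp_minus sub proj_res_span[OF lK col_carrier] by (metis subsetD)
  then have v: "?v \<in> double_perp n ?C"
    using double_perp_add double_perp_smult sub sign_dir_span[OF lK] by (metis subsetD)
  have "sign_dir (Suc l) = ?v"
  proof (rule double_perp_eqI[OF sign_dir_span[OF l] v cols_carrier])
    fix c assume "c \<in> ?C"
    then obtain m where m: "m \<in> {1..Suc l}" "c = col X (j m)" by auto
    have "slope l (j m) + ?b * pcov l (j m) e = s m"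
    proof (cases "m = Suc l")
      case True
      then show ?thesis using pcov_pos[OF lK e] by (simp add: e_def)
    next
      case False
      then have "m \<in> {1..l}" using m by auto
      then show ?thesis
        using slope_active[OF lK] proj_res_orth[OF lK col_carrier] by (simp add: pcov_eq[OF lK])
    qed
    then show "c \<bullet> sign_dir (Suc l) = c \<bullet> ?v"
      using m slope_active[OF l m(1)] inner by (simp add: slope_def)
  qed
  then show ?thesis using inner[of i] by (simp add: slope_def)
qed

lemma residual_0: "residual X y j s 0 t = y"
proof -
  have "sign_dir 0 = 0\<^sub>v n"
    using double_perp_eqI[OF sign_dir_span[of 0] _ cols_carrier, of "0\<^sub>v n"]
    by (simp add: double_perp_def)
  moreover have "y - proj_res 0 y = 0\<^sub>v n"
    using double_perp_eqI[OF proj_res_span[OF _ y_carrier, of 0] _ cols_carrier, of "0\<^sub>v n"]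
    by (simp add: double_perp_def)
  then have "y = proj_res 0 y"
    using vec_eq_of_minus_eq_0[OF y_carrier proj_res_carrier[OF _ y_carrier, of 0]] by simp
  ultimately show ?thesis
    using residual_eq[of 0 t] y_carrier by (intro eq_vecI) auto
qed

end


section \<open>Dynamics of the path and the truncation endpoints\<close>

lemma crossing_between:
  fixes f :: "real \<Rightarrow> real"
  assumes cont: "continuous_on {a..b} f" and ab: "a < b" and fa: "\<bar>f a\<bar> > a" and fb: "\<bar>f b\<bar> < b"
  shows "\<exists>t. a < t \<and> t < b \<and> \<bar>f t\<bar> = t"
proof -
  have "\<exists>t. a \<le> t \<and> t \<le> b \<and> \<bar>f t\<bar> - t = 0"
    using fa fb ab by (intro IVT2' continuous_intros cont) auto
  then obtain t where t: "a \<le> t" "t \<le> b" "\<bar>f t\<bar> = t" by auto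
  then have "t \<noteq> a" "t \<noteq> b" using fa fb by auto
  then show ?thesis using t by (intro exI[of _ t]) auto
qed

context lars_path
begin

lemma entry_residual_eq: "entry_residual X y j s lam (Suc l) = residual X y j s l (lam (Suc l))"
  by (simp add: entry_residual_def residual_0)

lemma entry_corr:
  assumes l: "l < K"
  shows "offset l (j (Suc l)) + lam (Suc l) * slope l (j (Suc l)) = lam (Suc l) * s (Suc l)"
proof -
  let ?c = "col X (j (Suc l)) \<bullet> residual X y j s l (lam (Suc l))"
  have "\<bar>?c\<bar> = lam (Suc l)" "s (Suc l) = sgn ?c"
    using step[OF l] by (auto simp: lars_step_def entry_residual_eq)
  then have "?c = lam (Suc l) * s (Suc l)"
    using abs_mult_sgn[of ?c] by simp
  then show ?thesis using corr_eq[of l] l by simp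
qed

lemma lam_nonneg: "l < K \<Longrightarrow> 0 \<le> lam (Suc l)"
  using step[of l] abs_ge_zero unfolding lars_step_def by metis

lemma sign_cases:
  assumes "l < K" "0 < lam (Suc l)"
  shows "s (Suc l) = 1 \<or> s (Suc l) = -1"
  using step[OF assms(1)] assms(2) by (auto simp: lars_step_def sgn_if split: if_splits)

lemma lam_decreasing: "Suc l < K \<Longrightarrow> lam (Suc (Suc l)) < lam (Suc l)"
  using step[of "Suc l"] by (simp add: lars_step_def knot_candidates_def)

lemma lam_pos:
  assumes k: "Suc l < K"
  shows "0 < lam (Suc l)"
  using lam_decreasing[OF k] lam_nonneg[OF k] by linarith

lemma lam_maximal:
  assumes l: "Suc l < K" and t: "t < lam (Suc l)" and i: "i \<in> inactive X j (Suc l)"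
    and eq: "\<bar>offset (Suc l) i + t * slope (Suc l) i\<bar> = t"
  shows "t \<le> lam (Suc (Suc l))"
proof -
  have "t \<in> knot_candidates X y j s lam (Suc (Suc l))"
    using t i eq corr_eq[of "Suc l"] l by (auto simp: knot_candidates_def)
  then show ?thesis using step[OF l] by (simp add: lars_step_def)
qed

lemma lam_1_max:
  assumes "0 < K" and i: "i < dim_col X"
  shows "\<bar>col X i \<bullet> y\<bar> \<le> lam 1"
  using step[OF assms(1)] i by (auto simp: lars_step_def intro!: Max_ge)

text \<open>
  At its knot the entering column already has the correlation that the enlarged active set prescribes,
  so both residuals subtract from \<open>y\<close> the same vector of the enlarged active span.
\<close>
lemma corr_continuous:
  assumes l: "l < K"
  shows "offset (Suc l) i + lam (Suc l) * slope (Suc l) i = offset l i + lam (Suc l) * slope l i"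
proof -
  let ?C = "col X ` j ` {1..Suc l}"
  let ?r = "\<lambda>l. residual X y j s l (lam (Suc l))"
  have lK: "l \<le> K" "Suc l \<le> K" using l by auto
  define r where "r m = residual X y j s m (lam (Suc l))" for m
  have y_minus: "y - r m \<in> double_perp n ?C" and r: "r m \<in> carrier_vec n"
    if m: "m \<le> K" "m \<le> Suc l" for m
  proof -
    have sub: "double_perp n (col X ` j ` {1..m}) \<subseteq> double_perp n ?C"
      using m by (intro double_perp_mono image_mono) auto
    have q: "proj_res m y \<in> carrier_vec n" and v: "sign_dir m \<in> carrier_vec n"
      using proj_res_carrier[OF m(1) y_carrier] sign_dir_carrier[OF m(1)] .
    show "r m \<in> carrier_vec n" unfolding r_def residual_eq[OF m(1)] using q v by simp
    have "y - r m = (y - proj_res m y) - lam (Suc l) \<cdot>\<^sub>v sign_dir m"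
      unfolding r_def residual_eq[OF m(1)] using q v y_carrier by (intro eq_vecI) auto
    then show "y - r m \<in> double_perp n ?C"
      using double_perp_minus[OF proj_res_span[OF m(1) y_carrier]
          double_perp_smult[OF sign_dir_span[OF m(1)]]] sub by auto
  qed
  have corr: "col X a \<bullet> (y - r m) = col X a \<bullet> y - (offset m a + lam (Suc l) * slope m a)"
    if "m \<le> K" "m \<le> Suc l" for m a
    using scalar_prod_minus_distrib[OF col_carrier y_carrier r[OF that]] corr_eq[OF that(1)]
    by (simp add: r_def)
  have active: "offset m (j b) + lam (Suc l) * slope m (j b) = lam (Suc l) * s b"
    if "m \<le> K" "b \<in> {1..m}" for m b
    using slope_active[OF that] proj_res_orth[OF that(1) y_carrier] that(2)
    by (simp add: offset_def)
  have "y - r (Suc l) = y - r l"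
  proof (rule double_perp_eqI[OF y_minus y_minus cols_carrier])
    fix c assume "c \<in> ?C"
    then obtain b where b: "b \<in> {1..Suc l}" "c = col X (j b)" by auto
    have "offset l (j b) + lam (Suc l) * slope l (j b) = lam (Suc l) * s b"
    proof (cases "b = Suc l")
      case True
      then show ?thesis using entry_corr[OF l] by simp
    next
      case False
      then show ?thesis using active[OF lK(1)] b by simp
    qed
    then show "c \<bullet> (y - r (Suc l)) = c \<bullet> (y - r l)"
      using active[OF lK(2) b(1)] corr lK b(2) by simp
  qed (use l in auto)
  then show ?thesis using corr[of "Suc l" i] corr[of l i] lK by simp
qed

text \<open>
  This is where generic position enters: an inactive column attaining the bound would be a second
  maximizer.
\<close>
lemma corr_strict:
  assumes l: "l < K" and i: "i \<in> inactive X j (Suc l)"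
    and le: "\<And>i. i \<in> inactive X j l \<Longrightarrow> \<bar>offset l i + lam (Suc l) * slope l i\<bar> \<le> lam (Suc l)"
  shows "\<bar>offset (Suc l) i + lam (Suc l) * slope (Suc l) i\<bar> < lam (Suc l)"
proof (rule ccontr)
  let ?c = "\<lambda>i. \<bar>col X i \<bullet> entry_residual X y j s lam (Suc l)\<bar>"
  let ?P = "is_arg_max ?c (\<lambda>i. i \<in> inactive X j l)"
  have c: "?c a = \<bar>offset l a + lam (Suc l) * slope l a\<bar>" for a
    using corr_eq[of l] l by (simp add: entry_residual_eq)
  have max: "?P a" if "a \<in> inactive X j l" "?c a = lam (Suc l)" for a
  proof -
    have "\<not> ?c a < ?c b" if "b \<in> inactive X j l" for b
      using le[OF that] \<open>?c a = lam (Suc l)\<close> c[of b] by linarith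
    then show ?thesis using that(1) by (auto simp: is_arg_max_def)
  qed
  assume "\<not> ?thesis"
  then have "?c i \<ge> lam (Suc l)"
    unfolding corr_continuous[OF l] c by simp
  moreover have il: "i \<in> inactive X j l" "i \<noteq> j (Suc l)"
    using i by (auto simp: inactive_Suc)
  ultimately have "?c i = lam (Suc l)" using le[OF il(1)] c[of i] by linarith
  then have "?P i" using max il by blast
  moreover have "?P (j (Suc l))"
    using max[OF entering[OF l]] step[OF l] by (simp add: lars_step_def)
  moreover have "\<exists>!a. ?P a"
    using generic[unfolded generic_position_def, THEN bspec, of "Suc l"] l by simp
  ultimately show False using il(2) by blast
qed

text \<open>
  Strictness at the previous knot together with a violation at the next one would force a crossing in
  between, against the choice of the next knot as the largest crossing.
\<close>
lemma corr_le:
  assumes "l < K" and "i \<in> inactive X j l"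
  shows "\<bar>offset l i + lam (Suc l) * slope l i\<bar> \<le> lam (Suc l)"
  using assms
proof (induction l arbitrary: i)
  case 0
  have "\<bar>col X i \<bullet> y\<bar> \<le> lam 1" using lam_1_max 0 by (simp add: inactive_iff)
  then show ?case using corr_eq[of 0 i "lam 1"] by (simp add: residual_0)
next
  case (Suc l)
  let ?f = "\<lambda>t. offset (Suc l) i + t * slope (Suc l) i"
  have lK: "l < K" using Suc.prems by simp
  show ?case
  proof (rule ccontr)
    assume "\<not> ?thesis"
    then have "\<bar>?f (lam (Suc (Suc l)))\<bar> > lam (Suc (Suc l))" by simp
    moreover have "\<bar>?f (lam (Suc l))\<bar> < lam (Suc l)"
      by (rule corr_strict[OF lK Suc.prems(2)]) (rule Suc.IH[OF lK])
    moreover have "continuous_on {lam (Suc (Suc l))..lam (Suc l)} ?f"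
      by (intro continuous_intros)
    ultimately obtain t where "lam (Suc (Suc l)) < t" "t < lam (Suc l)" "\<bar>?f t\<bar> = t"
      using crossing_between lam_decreasing[OF Suc.prems(1)] by blast
    then show False using lam_maximal[OF Suc.prems(1) _ Suc.prems(2)] by fastforce
  qed
qed

lemma corr_less:
  assumes "l < K" and "i \<in> inactive X j (Suc l)"
  shows "\<bar>offset (Suc l) i + lam (Suc l) * slope (Suc l) i\<bar> < lam (Suc l)"
  using corr_strict[OF assms] corr_le[OF assms(1)] by blast

text \<open>
  If the slope of the entering column equalled its sign, its correlation would meet the line
  \<open>s * t\<close> at every penalty, hence already at the previous knot, where the inactive correlations
  are strictly smaller than the penalty.
\<close>
lemma entry_denom:
  assumes l: "l < K" and pos: "0 < lam (Suc l)"
  shows "s (Suc l) \<noteq> slope l (j (Suc l))"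
proof (cases l)
  case 0
  then show ?thesis using sign_cases[OF l pos] slope_0 by auto
next
  case (Suc m)
  let ?e = "j (Suc l)"
  show ?thesis
  proof
    assume eq: "s (Suc l) = slope l ?e"
    then have "offset l ?e = 0" using entry_corr[OF l] by simp
    moreover have "\<bar>slope l ?e\<bar> = 1" using eq sign_cases[OF l pos] by auto
    moreover have "\<bar>offset l ?e + lam l * slope l ?e\<bar> < lam l"
      using corr_less[of m ?e] entering[OF l] l by (simp add: Suc)
    ultimately show False by (simp add: abs_mult)
  qed
qed

text \<open>
  The slope bound fixes the sign of \<open>\<sigma> - slope l i\<close>, which allows dividing the bound on the
  correlation by it.  A vanishing denominator makes the left side 0, below the nonnegative knot.
\<close>
lemma candidate_le:
  assumes l: "l < K" and i: "i \<in> inactive X j l" and \<sigma>: "\<sigma> \<in> {-1, 1}"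
  shows "c_tilde X j s (Suc l) i \<sigma> \<bullet> y \<le> lam (Suc l)"
proof -
  let ?o = "offset l i" and ?a = "slope l i" and ?t = "lam (Suc l)"
  have ab: "\<bar>?a\<bar> \<le> 1" using slope_bound[of l i] i l by (simp add: inactive_iff)
  have co: "\<bar>?o + ?t * ?a\<bar> \<le> ?t" by (rule corr_le[OF l i])
  have "?o / (\<sigma> - ?a) \<le> ?t"
  proof (cases "\<sigma> = ?a")
    case True
    then show ?thesis using lam_nonneg[OF l] by simp
  next
    case False
    show ?thesis
    proof (cases "\<sigma> = 1")
      case True
      then have "\<sigma> - ?a > 0" using ab False by auto
      moreover have "?o \<le> ?t * (\<sigma> - ?a)" using co True by (simp add: algebra_simps abs_le_iff)
      ultimately show ?thesis by (simp add: pos_divide_le_eq)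
    next
      case neg: False
      then have "\<sigma> = -1" using \<sigma> by simp
      then have "\<sigma> - ?a < 0" using ab False by auto
      moreover have "?o \<ge> ?t * (\<sigma> - ?a)"
        using co \<open>\<sigma> = -1\<close> by (simp add: algebra_simps abs_le_iff)
      ultimately show ?thesis by (simp add: neg_divide_le_eq)
    qed
  qed
  then show ?thesis using c_tilde_inner_y[of l] l by simp
qed

text \<open>
  At a knot equal to 0 the entering sign is \<open>sgn 0 = 0\<close>, which is not one of the competing signs;
  there the offset vanishes and every admissible \<open>\<sigma>\<close> attains the knot.
\<close>
lemma candidate_entering:
  assumes l: "l < K" and ne: "\<sigma> \<noteq> slope l (j (Suc l))"
    and "lam (Suc l) = 0 \<or> \<sigma> = s (Suc l)"
  shows "c_tilde X j s (Suc l) (j (Suc l)) \<sigma> \<bullet> y = lam (Suc l)"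
proof -
  have "offset l (j (Suc l)) = lam (Suc l) * (\<sigma> - slope l (j (Suc l)))"
    using entry_corr[OF l] assms(3) by (auto simp: algebra_simps)
  then show ?thesis using c_tilde_inner_y[of l] l ne by simp
qed

text \<open>
  The claim is the positivity of the quotient of the new by the old value of \<open>\<sigma> - slope\<close>.
  Both values have the sign of \<open>\<sigma>\<close> or vanish, by the slope bound before and after the step.
\<close>
lemma inner_less:
  assumes l: "l < K" and pos: "0 < lam (Suc l)"
    and i: "i \<in> inactive X j (Suc l)" and \<sigma>: "\<sigma> \<in> {-1, 1}"
    and nz: "c_denom X j s (Suc (Suc l)) i \<sigma> \<noteq> 0"
  shows "c_tilde X j s (Suc l) i \<sigma> \<bullet> c_entry X j s (Suc l) <
    c_entry X j s (Suc l) \<bullet> c_entry X j s (Suc l)"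
proof -
  define e where "e = j (Suc l)"
  define d where "d = s (Suc l) - slope l e"
  define D where "D = \<sigma> - slope l i"
  have lK: "l \<le> K" "Suc l \<le> K" using l by auto
  have P: "pcov l e e > 0" using pcov_pos[OF lK(1) entering[OF l]] by (simp add: e_def)
  have d: "d \<noteq> 0" using entry_denom[OF l pos] by (simp add: d_def e_def)
  have new: "\<sigma> - slope (Suc l) i = D - d / pcov l e e * pcov l i e"
    using slope_update[OF lK(2)] by (simp add: D_def d_def e_def)
  have i_lt: "i < dim_col X" using i by (simp add: inactive_iff)
  have b: "\<bar>slope l i\<bar> \<le> 1" "\<bar>slope (Suc l) i\<bar> \<le> 1"
    using slope_bound[OF lK(1) i_lt] slope_bound[OF lK(2) i_lt] .
  have nz': "\<sigma> - slope (Suc l) i \<noteq> 0" using nz by (simp add: denom_eq)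
  have ratio: "0 < pcov l e e / (d * d)"
    using not_real_square_gt_zero[of d] d by (intro divide_pos_pos P) blast
  have goal: "pcov l i e / (D * d) < pcov l e e / (d * d)"
  \<comment> \<open>A vanishing old denominator makes \<open>c_tilde\<close> zero, so the left side is 0.\<close>
  proof (cases "D = 0")
    case True
    then show ?thesis using ratio by simp
  next
    case False
    have same: "0 < (D - d / pcov l e e * pcov l i e) / D"
      using \<sigma> b nz' False unfolding new[symmetric] unfolding D_def
      by (auto simp: zero_less_divide_iff)
    then have "d * pcov l i e / (pcov l e e * D) < 1"
      using False by (simp add: diff_divide_distrib)
    then have "d * pcov l i e / (pcov l e e * D) * (pcov l e e / (d * d)) <
        1 * (pcov l e e / (d * d))"
      by (rule mult_strict_right_mono[OF _ ratio])
    moreover have "d * pcov l i e / (pcov l e e * D) * (pcov l e e / (d * d)) =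
        pcov l i e / (D * d)"
      using P d False by (simp add: divide_simps)
    ultimately show ?thesis by simp
  qed
  show ?thesis
    using goal c_tilde_inner[OF lK(1)] by (simp add: D_def d_def e_def)
qed

lemma lower_endpoint_eq:
  assumes k: "Suc l < K"
  shows "lower_endpoint X y j s (Suc l) = lam (Suc (Suc l))"
proof -
  have l: "l < K" using k by simp
  note pos = lam_pos[OF k]
  let ?T = "{(i, \<sigma>) \<in> S_plus X y j s (Suc l). c_denom X j s (Suc l + 1) i \<sigma> \<noteq> 0}"
  let ?f = "\<lambda>(i, \<sigma>). c_tilde X j s (Suc l + 1) i \<sigma> \<bullet> y"
  have entry: "c_entry X j s (Suc l) \<bullet> y = lam (Suc l)"
    by (rule candidate_entering[OF l entry_denom[OF l pos]]) simp
  \<comment> \<open>Both inequalities of \<open>S_plus\<close> follow from a nonzero new denominator.\<close>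
  have T: "(i, \<sigma>) \<in> ?T \<longleftrightarrow>
      i \<in> inactive X j (Suc l) \<and> \<sigma> \<in> {-1, 1} \<and> c_denom X j s (Suc (Suc l)) i \<sigma> \<noteq> 0" for i \<sigma>
  proof
    assume r: "i \<in> inactive X j (Suc l) \<and> \<sigma> \<in> {-1, 1} \<and>
      c_denom X j s (Suc (Suc l)) i \<sigma> \<noteq> 0"
    then have "i \<in> inactive X j l" by (simp add: inactive_Suc)
    then have "c_tilde X j s (Suc l) i \<sigma> \<bullet> y \<le> c_entry X j s (Suc l) \<bullet> y"
      using candidate_le[OF l] r entry by simp
    then show "(i, \<sigma>) \<in> ?T"
      using inner_less[OF l pos] r by (simp add: S_plus_def)
  qed (simp add: S_plus_def)
  have "finite ?T"
  proof (rule finite_subset)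
    show "?T \<subseteq> {..<dim_col X} \<times> {-1, 1}"
    proof
      fix p assume p: "p \<in> ?T"
      obtain i \<sigma> where "p = (i, \<sigma>)" by (cases p)
      then show "p \<in> {..<dim_col X} \<times> {-1, 1}"
        using p T[of i \<sigma>] by (simp add: inactive_iff)
    qed
  qed simp
  moreover have "lam (Suc (Suc l)) \<in> ?f ` ?T"
  proof -
    let ?e = "j (Suc (Suc l))"
    have "\<exists>\<sigma> \<in> {-1, 1}. \<sigma> \<noteq> slope (Suc l) ?e \<and>
        (lam (Suc (Suc l)) = 0 \<or> \<sigma> = s (Suc (Suc l)))"
    proof (cases "lam (Suc (Suc l)) = 0")
      case True
      have "(1 :: real) \<noteq> slope (Suc l) ?e \<or> -1 \<noteq> slope (Suc l) ?e" by linarith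
      then show ?thesis using True by blast
    next
      case False
      then have "0 < lam (Suc (Suc l))" using lam_nonneg[OF k] by simp
      then show ?thesis using sign_cases[OF k] entry_denom[OF k] by blast
    qed
    then obtain \<sigma> where \<sigma>: "\<sigma> \<in> {-1, 1}" "\<sigma> \<noteq> slope (Suc l) ?e"
      "lam (Suc (Suc l)) = 0 \<or> \<sigma> = s (Suc (Suc l))" by blast
    have "(?e, \<sigma>) \<in> ?T"
      unfolding T using entering[OF k] \<sigma> by (simp add: denom_eq)
    moreover have "?f (?e, \<sigma>) = lam (Suc (Suc l))"
      using candidate_entering[OF k \<sigma>(2,3)] by simp
    ultimately show ?thesis by (intro image_eqI[of _ _ "(?e, \<sigma>)"]) auto
  qed
  moreover have "v \<le> lam (Suc (Suc l))" if "v \<in> ?f ` ?T" for v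
  proof -
    from that obtain p where p: "p \<in> ?T" "v = ?f p" by (rule imageE)
    obtain i \<sigma> where "p = (i, \<sigma>)" by (cases p)
    then show ?thesis using p T[of i \<sigma>] candidate_le[OF k, of i \<sigma>] by simp
  qed
  ultimately show ?thesis
    unfolding lower_endpoint_def by (intro Max_eqI finite_imageI)
qed

lemma upper_endpoint_infinite:
  assumes l: "l < K" and pos: "0 < lam (Suc l)"
  shows "upper_endpoint X y j s (Suc l) = \<infinity>"
proof -
  have "{(i, \<sigma>) \<in> S_minus X y j s (Suc l). c_denom X j s (Suc l + 1) i \<sigma> \<noteq> 0} = {}"
    using inner_less[OF l pos] by (force simp: S_minus_def)
  then show ?thesis unfolding upper_endpoint_def by (simp only: image_empty Inf_empty top_ereal_def)
qed

theorem selection_event_iff: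
  assumes k: "1 \<le> k" "k < K"
  shows "selection_event X y j s k \<longleftrightarrow>
      (\<forall>l \<in> {1..<k}. c_entry X j s l \<bullet> y \<ge> c_entry X j s (l + 1) \<bullet> y) \<and>
      c_entry X j s k \<bullet> y \<ge> lam (k + 1)"
proof -
  obtain m where m: "k = Suc m" using k by (cases k) auto
  have "upper_endpoint X y j s l = \<infinity>" if "l \<in> {1..k}" for l
    using that k upper_endpoint_infinite[of "l - 1"] lam_pos[of "l - 1"] by auto
  moreover have "0 \<le> lam (k + 1)" using lam_nonneg[of k] k by simp
  moreover have "lower_endpoint X y j s k = lam (k + 1)"
    using lower_endpoint_eq[of m] k m by simp
  ultimately show ?thesis unfolding selection_event_def by auto
qed

end


section \<open>The fused lasso design\<close>

text \<open>
  At the leftmost point where an excessive maximum is attained, the left neighbour is strictly smaller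
  and the right one not larger, so the value there is not the mean of its neighbours.
\<close>
lemma discrete_maximum_principle:
  fixes H :: "nat \<Rightarrow> real"
  assumes ends: "H 0 \<le> b" "H n \<le> b"
    and interior: "\<And>m. 0 < m \<Longrightarrow> m < n \<Longrightarrow> H m \<le> b \<or> 2 * H m = H (m - 1) + H (m + 1)"
    and m: "m \<le> n"
  shows "H m \<le> b"
proof (rule ccontr)
  assume gt: "\<not> H m \<le> b"
  define M where "M = Max (H ` {..n})"
  have le: "H i \<le> M" if "i \<le> n" for i
    unfolding M_def using that by (intro Max_ge) auto
  have "M \<in> H ` {..n}" unfolding M_def by (intro Max_in) auto
  then have ex: "\<exists>i. i \<le> n \<and> H i = M" by auto
  define p where "p = (LEAST i. i \<le> n \<and> H i = M)"
  have p: "p \<le> n" "H p = M" using LeastI_ex[OF ex] by (auto simp: p_def)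
  have Mb: "M > b" using le[OF m] gt by linarith
  then have "p \<noteq> 0" "p \<noteq> n" using p(2) ends by (metis leD)+
  then have p_in: "0 < p" "p < n" using p(1) by auto
  have "H (p - 1) \<noteq> M"
  proof
    assume "H (p - 1) = M"
    then have "p \<le> p - 1" using p unfolding p_def by (intro Least_le) auto
    then show False using p_in by simp
  qed
  moreover have "H (p - 1) \<le> M" "H (p + 1) \<le> M"
    by (rule le, use p_in in simp)+
  ultimately show False using interior[OF p_in] p(2) Mb by linarith
qed

lemma D_tilde_carrier: "n \<ge> 1 \<Longrightarrow> D_tilde n \<in> carrier_mat n n"
  using carrier_append_rows[of "diff_mat n" "n - 1" n "mat 1 n (\<lambda>_. 1)" 1]
  unfolding D_tilde_def diff_mat_def by simp

lemma D_tilde_apply: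
  assumes n: "n \<ge> 1" and x: "x \<in> carrier_vec n"
  shows "r < n - 1 \<Longrightarrow> (D_tilde n *\<^sub>v x) $ r = x $ Suc r - x $ r"
    and "(D_tilde n *\<^sub>v x) $ (n - 1) = (\<Sum>i < n. x $ i)"
proof -
  have d: "diff_mat n \<in> carrier_mat (n - 1) n" by (simp add: diff_mat_def)
  have e: "mat 1 n (\<lambda>_. 1 :: real) \<in> carrier_mat 1 n" by simp
  have eq: "D_tilde n *\<^sub>v x = (diff_mat n *\<^sub>v x) @\<^sub>v (mat 1 n (\<lambda>_. 1) *\<^sub>v x)"
    unfolding D_tilde_def by (rule mat_mult_append[OF d e x])
  show "(D_tilde n *\<^sub>v x) $ (n - 1) = (\<Sum>i < n. x $ i)"
    unfolding eq using d x by (simp add: scalar_prod_def atLeast0LessThan)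
  assume r: "r < n - 1"
  have "(diff_mat n *\<^sub>v x) $ r = (\<Sum>i < n. (if i = r + 1 then 1 else if i = r then -1 else 0) * x $ i)"
    using r x by (simp add: diff_mat_def scalar_prod_def atLeast0LessThan)
  also have "\<dots> = (\<Sum>i < n. (if i = r + 1 then x $ i else 0) - (if i = r then x $ i else 0))"
    by (intro sum.cong) auto
  also have "\<dots> = x $ Suc r - x $ r"
    using r by (simp add: sum_subtractf)
  finally show "(D_tilde n *\<^sub>v x) $ r = x $ Suc r - x $ r"
    unfolding eq using r d by (simp add: index_append_vec)
qed

lemma constant_of_zero_differences:
  fixes x :: "real vec"
  assumes "\<And>r. r < n - 1 \<Longrightarrow> x $ Suc r - x $ r = 0"
  shows "r < n \<Longrightarrow> x $ r = x $ 0"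
proof (induction r)
  case (Suc r)
  then show ?case using assms[of r] by simp
qed simp

lemma D_tilde_inverse:
  assumes n: "n \<ge> 1"
  shows "minv (D_tilde n) \<in> carrier_mat n n" "D_tilde n * minv (D_tilde n) = 1\<^sub>m n"
proof -
  have "x = 0\<^sub>v n" if x: "x \<in> carrier_vec n" and z: "D_tilde n *\<^sub>v x = 0\<^sub>v n" for x
  proof -
    have const: "x $ r = x $ 0" if "r < n" for r
      using constant_of_zero_differences[of n x r] that D_tilde_apply(1)[OF n x] z by simp
    have "0 = (\<Sum>i < n. x $ i)" using D_tilde_apply(2)[OF n x] z n by simp
    also have "\<dots> = (\<Sum>i < n. x $ 0)" by (intro sum.cong) (auto intro: const)
    finally have "x $ 0 = 0" using n by simp
    then have "x $ r = 0" if "r < n" for r using const[OF that] by simp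
    then show ?thesis using x by (intro eq_vecI) auto
  qed
  then show "minv (D_tilde n) \<in> carrier_mat n n" "D_tilde n * minv (D_tilde n) = 1\<^sub>m n"
    using minv_inverse[OF D_tilde_carrier[OF n]] by blast+
qed

lemma D_tilde_inverse_col:
  assumes n: "n \<ge> 1" and c: "c < n"
  defines "x \<equiv> col (minv (D_tilde n)) c"
  shows "x \<in> carrier_vec n"
    and "r < n - 1 \<Longrightarrow> x $ Suc r - x $ r = (if r = c then 1 else 0)"
    and "(\<Sum>i < n. x $ i) = (if c = n - 1 then 1 else 0)"
proof -
  show x: "x \<in> carrier_vec n" unfolding x_def by (rule col_carrier_vec[OF c D_tilde_inverse(1)[OF n]])
  have "D_tilde n *\<^sub>v x = col (D_tilde n * minv (D_tilde n)) c"
    unfolding x_def by (rule col_mult2[symmetric, OF D_tilde_carrier[OF n] D_tilde_inverse(1)[OF n] c])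
  then have e: "D_tilde n *\<^sub>v x = unit_vec n c"
    using D_tilde_inverse(2)[OF n] c by simp
  show "r < n - 1 \<Longrightarrow> x $ Suc r - x $ r = (if r = c then 1 else 0)"
    using D_tilde_apply(1)[OF n x, of r] e c by simp
  show "(\<Sum>i < n. x $ i) = (if c = n - 1 then 1 else 0)"
    using D_tilde_apply(2)[OF n x] e c n by (cases "c = n - 1") auto
qed

lemma X2_carrier: "X2 n \<in> carrier_mat n 1"
  using mat_of_cols_carrier(1)[of n "[col (minv (D_tilde n)) (n - 1)]"] by (simp add: X2_def)

lemma X1_carrier: "X1 n \<in> carrier_mat n (n - 1)"
  using mat_of_cols_carrier(1)[of n "map (col (minv (D_tilde n))) [0..<n - 1]"] by (simp add: X1_def)

lemma col_X1: "n \<ge> 1 \<Longrightarrow> c < n - 1 \<Longrightarrow> col (X1 n) c = col (minv (D_tilde n)) c"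
  using D_tilde_inverse_col(1)[of n c] unfolding X1_def by (subst col_mat_of_cols) auto

lemma X2_constant:
  assumes n: "n \<ge> 1"
  shows "\<exists>a. a \<noteq> 0 \<and> (\<forall>r < n. X2 n $$ (r, 0) = a)"
proof -
  define x where "x = col (minv (D_tilde n)) (n - 1)"
  have x: "x \<in> carrier_vec n" "r < n - 1 \<Longrightarrow> x $ Suc r - x $ r = 0" "(\<Sum>i < n. x $ i) = 1" for r
    using D_tilde_inverse_col[OF n, of "n - 1"] n by (auto simp: x_def)
  have const: "x $ r = x $ 0" if "r < n" for r
    by (rule constant_of_zero_differences[OF x(2) that])
  have "x $ 0 \<noteq> 0"
  proof
    assume "x $ 0 = 0"
    then have "x $ r = 0" if "r < n" for r using const[OF that] by simp
    then have "(\<Sum>i < n. x $ i) = 0" by simp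
    then show False using x(3) by simp
  qed
  moreover have "X2 n $$ (r, 0) = x $ 0" if "r < n" for r
    using const[OF that] that by (simp add: X2_def x_def mat_of_cols_Cons_index_0)
  ultimately show ?thesis
    by (intro exI[of _ "x $ 0"] conjI allI impI)
qed

text \<open>
  The second block is a constant column, orthogonal to every vector with zero sum.  The columns of
  \<open>X1\<close> are such vectors, so the projection leaves them unchanged.
\<close>
lemma X2_projection_fixes:
  assumes n: "n \<ge> 1" and x: "x \<in> carrier_vec n" and sum: "(\<Sum>i < n. x $ i) = 0"
  shows "(1\<^sub>m n - col_proj (X2 n)) *\<^sub>v x = x"
proof -
  obtain a where a: "a \<noteq> 0" "\<forall>r < n. X2 n $$ (r, 0) = a" using X2_constant[OF n] by blast
  have inj: "w = 0\<^sub>v 1" if w: "w \<in> carrier_vec 1" and z: "X2 n *\<^sub>v w = 0\<^sub>v n" for w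
  proof -
    have "(X2 n *\<^sub>v w) $ 0 = a * w $ 0"
      using X2_carrier[of n] w n a(2) by (simp add: scalar_prod_def)
    then have "w $ 0 = 0" using z n a(1) by simp
    then show ?thesis using w by (intro eq_vecI) auto
  qed
  have M: "minv ((X2 n)\<^sup>T * X2 n) \<in> carrier_mat 1 1"
    by (rule gram_solution(1)[OF X2_carrier inj, where r = "0\<^sub>v 1"]) auto
  have "(X2 n)\<^sup>T *\<^sub>v x = 0\<^sub>v 1"
  proof (rule eq_vecI)
    fix i assume "i < dim_vec (0\<^sub>v 1)"
    then have "i = 0" by simp
    moreover have "((X2 n)\<^sup>T *\<^sub>v x) $ 0 = (\<Sum>r < n. a * x $ r)"
      using X2_carrier[of n] x a(2) by (simp add: scalar_prod_def atLeast0LessThan)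
    ultimately show "((X2 n)\<^sup>T *\<^sub>v x) $ i = 0\<^sub>v 1 $ i"
      using sum by (simp add: sum_distrib_left[symmetric])
  qed (use X2_carrier[of n] in simp)
  then have "(1\<^sub>m n - col_proj (X2 n)) *\<^sub>v x = x - X2 n *\<^sub>v (minv ((X2 n)\<^sup>T * X2 n) *\<^sub>v 0\<^sub>v 1)"
    using col_proj_apply[OF X2_carrier M x] by simp
  then show ?thesis using M X2_carrier[of n] x by (intro eq_vecI) (auto simp: scalar_prod_def)
qed

lemma X2_res_carrier: "1\<^sub>m n - col_proj (X2 n) \<in> carrier_mat n n"
proof -
  have "col_proj (X2 n) \<in> carrier_mat n n"
    using X2_carrier[of n] by (intro carrier_matI) (auto simp: col_proj_def)
  then show ?thesis by (rule minus_carrier_mat)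
qed

lemma X_tilde_carrier: "X_tilde n \<in> carrier_mat n (n - 1)"
  unfolding X_tilde_def by (rule mult_carrier_mat[OF X2_res_carrier X1_carrier])

lemma col_X_tilde:
  assumes n: "n \<ge> 1" and c: "c < n - 1"
  shows "col (X_tilde n) c = col (minv (D_tilde n)) c"
proof -
  have cn: "c < n" using c by simp
  have "col (X_tilde n) c = (1\<^sub>m n - col_proj (X2 n)) *\<^sub>v col (X1 n) c"
    unfolding X_tilde_def by (rule col_mult2[OF X2_res_carrier X1_carrier c])
  then show ?thesis
    using X2_projection_fixes[OF n D_tilde_inverse_col(1)[OF n cn]]
      D_tilde_inverse_col(3)[OF n cn] c by (simp add: col_X1[OF n c])
qed

lemma y_tilde_carrier: "y \<in> carrier_vec n \<Longrightarrow> y_tilde n y \<in> carrier_vec n"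
  unfolding y_tilde_def by (rule mult_mat_vec_carrier[OF X2_res_carrier])

text \<open>
  Every design column is constant except for a unit jump after position \<open>c\<close>.  Its inner product with
  a vector of zero sum is therefore a tail sum of that vector, that is, minus an initial sum.
\<close>
lemma step_column_inner:
  fixes x v :: "nat \<Rightarrow> real"
  assumes step: "\<And>r. Suc r < n \<Longrightarrow> x (Suc r) - x r = (if r = c then 1 else 0)"
    and c: "c < n" and sum: "(\<Sum>i < n. v i) = 0"
  shows "(\<Sum>i < n. x i * v i) = - (\<Sum>i < Suc c. v i)"
proof -
  have x: "x r = x 0 + (if r \<le> c then 0 else 1)" if "r < n" for r
    using that
  proof (induction r)
    case (Suc r)
    then show ?case using step[of r] by (auto split: if_splits)
  qed simp
  have "(\<Sum>i < n. x i * v i) = (\<Sum>i < n. (x 0 + 1) * v i - (if i \<le> c then v i else 0))"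
  proof (intro sum.cong refl)
    fix i assume "i \<in> {..<n}"
    then show "x i * v i = (x 0 + 1) * v i - (if i \<le> c then v i else 0)"
      using x[of i] by (simp add: distrib_right)
  qed
  also have "\<dots> = - (\<Sum>i < n. if i \<le> c then v i else 0)"
    using sum by (simp add: sum_subtractf sum_distrib_left[symmetric])
  also have "(\<Sum>i < n. if i \<le> c then v i else 0) = (\<Sum>i < Suc c. v i)"
    using c by (intro sum.mono_neutral_cong_right) auto
  finally show ?thesis .
qed

text \<open>
  The difference functionals are dual to the columns.  For a vector \<open>v\<close> in the span of \<open>A\<close>, the
  correlations are the negated partial sums \<open>H\<close> of \<open>v\<close>, with value 0 at both ends.  The difference
  functional of an inactive position annihilates the active columns, hence \<open>v\<close>; so \<open>H\<close> has vanishing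
  second difference there, and the maximum principle applies to \<open>H\<close> and \<open>- H\<close>.
\<close>
lemma fused_lasso_design:
  assumes n: "n \<ge> 1"
  shows "lars_design n (X_tilde n)"
proof
  let ?X = "X_tilde n"
  have dim: "dim_col ?X = n - 1" using X_tilde_carrier by auto
  show "?X \<in> carrier_mat n (dim_col ?X)" unfolding dim by (rule X_tilde_carrier)
  have col: "col ?X c \<in> carrier_vec n"
    "Suc r < n \<Longrightarrow> col ?X c $ Suc r - col ?X c $ r = (if r = c then 1 else 0)"
    "(\<Sum>i < n. col ?X c $ i) = 0" if "c < n - 1" for c r
    using D_tilde_inverse_col[OF n, of c] that by (simp_all add: col_X_tilde[OF n that])
  define z :: "nat \<Rightarrow> real vec" where "z c = unit_vec n (Suc c) - unit_vec n c" for c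
  have z: "z c \<in> carrier_vec n" for c by (simp add: z_def)
  have z_inner: "z c \<bullet> x = x $ Suc c - x $ c" if "Suc c < n" "x \<in> carrier_vec n" for c x
    unfolding z_def
    using minus_scalar_prod_distrib[OF unit_vec_carrier unit_vec_carrier that(2)] that by simp
  have z_dual: "z c \<bullet> col ?X a = (if a = c then 1 else 0)" if "c < n - 1" "a < n - 1" for a c
    using z_inner[OF _ col(1)[OF that(2)], of c] col(2)[OF that(2), of c] that by auto
  show "\<exists>z \<in> carrier_vec n. \<forall>a < dim_col ?X. z \<bullet> col ?X a = (if a = c then 1 else 0)"
    if "c < dim_col ?X" for c
    using z_dual[OF that[unfolded dim]] z[of c] unfolding dim by (intro bexI[of _ "z c"]) auto
  fix A v i
  assume A: "A \<subseteq> {..<dim_col ?X}" and span: "v \<in> double_perp n (col ?X ` A)"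
    and bound: "\<forall>a \<in> A. \<bar>col ?X a \<bullet> v\<bar> \<le> 1" and i: "i < dim_col ?X"
  have v: "v \<in> carrier_vec n" by (rule double_perp_carrier[OF span])
  define u :: "real vec" where "u = vec n (\<lambda>_. 1)"
  have u: "u \<in> carrier_vec n" "u \<bullet> x = (\<Sum>i < n. x $ i)" if "x \<in> carrier_vec n" for x
    using that by (auto simp: u_def scalar_prod_def atLeast0LessThan)
  have "u \<bullet> v = 0"
  proof (rule double_perp_orth[OF span])
    fix x assume "x \<in> col ?X ` A"
    then obtain a where a: "a \<in> A" "x = col ?X a" by blast
    then have "a < n - 1" using A dim by auto
    then show "u \<bullet> x = 0" unfolding a(2) using u(2)[OF col(1)] col(3) by simp
  qed (simp add: u_def)
  then have sum_v: "(\<Sum>i < n. v $ i) = 0" using u(2)[OF v] by simp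
  \<comment> \<open>Column \<open>c\<close> has correlation \<open>H (Suc c)\<close>; the shift makes room for the boundary value \<open>H 0\<close>.\<close>
  define H where "H m = - (\<Sum>r < m. v $ r)" for m
  have inner: "col ?X c \<bullet> v = H (Suc c)" if "c < n - 1" for c
    unfolding H_def
    using step_column_inner[of n "\<lambda>r. col ?X c $ r" c "\<lambda>r. v $ r", OF col(2)[OF that] _ sum_v] that v
    by (simp add: scalar_prod_def atLeast0LessThan)
  have balance: "\<bar>H m\<bar> \<le> 1 \<or> 2 * H m = H (m - 1) + H (m + 1)" if m: "0 < m" "m < n" for m
  proof -
    obtain c where c: "m = Suc c" "c < n - 1" using m by (cases m) auto
    show ?thesis
    proof (cases "c \<in> A")
      case True
      then show ?thesis using bound inner[OF c(2)] c(1) by auto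
    next
      case False
      have "z c \<bullet> v = 0"
      proof (rule double_perp_orth[OF span z])
        fix x assume "x \<in> col ?X ` A"
        then obtain a where a: "a \<in> A" "x = col ?X a" by blast
        then have "a < n - 1" "a \<noteq> c" using A dim False by auto
        then show "z c \<bullet> x = 0" unfolding a(2) using z_dual[OF c(2)] by simp
      qed
      then have "v $ Suc c = v $ c" using z_inner[OF _ v] c by simp
      then show ?thesis by (simp add: H_def c(1))
    qed
  qed
  have ends: "H 0 = 0" "H n = 0" using sum_v by (auto simp: H_def)
  have "H (Suc i) \<le> 1"
  proof (rule discrete_maximum_principle)
    show "H m \<le> 1 \<or> 2 * H m = H (m - 1) + H (m + 1)" if "0 < m" "m < n" for m
      using balance[OF that] by linarith
  qed (use ends i dim in auto)
  moreover have "- H (Suc i) \<le> 1"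
  proof (rule discrete_maximum_principle[of "\<lambda>m. - H m"])
    show "- H m \<le> 1 \<or> 2 * - H m = - H (m - 1) + - H (m + 1)" if "0 < m" "m < n" for m
      using balance[OF that] by linarith
  qed (use ends i dim in auto)
  ultimately show "\<bar>col ?X i \<bullet> v\<bar> \<le> 1" using inner[of i] i by (simp add: dim)
qed

section \<open>Collapse of the truncation endpoints\<close>

theorem theorem2:
  fixes n K k :: nat and y :: "real vec"
    and j :: "nat \<Rightarrow> nat" and s lam :: "nat \<Rightarrow> real"
  assumes "n \<ge> 2" and "y \<in> carrier_vec n"
    and "lars_run (X_tilde n) (y_tilde n y) K j s lam"
    and "generic_position (X_tilde n) (y_tilde n y) K j s lam"
    and "1 \<le> k" and "k + 1 \<le> K"
  shows "lower_endpoint (X_tilde n) (y_tilde n y) j s k = lam (k + 1) \<and>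
    (selection_event (X_tilde n) (y_tilde n y) j s k \<longleftrightarrow>
      (\<forall>l \<in> {1..<k}. c_entry (X_tilde n) j s l \<bullet> y_tilde n y
                      \<ge> c_entry (X_tilde n) j s (l + 1) \<bullet> y_tilde n y) \<and>
      c_entry (X_tilde n) j s k \<bullet> y_tilde n y \<ge> lam (k + 1))"
proof -
  have "lars_design n (X_tilde n)"
    using fused_lasso_design assms(1) by simp
  then interpret lars_path n "X_tilde n" "y_tilde n y" K j s lam
    by (intro lars_path.intro lars_path_axioms.intro y_tilde_carrier assms)
  obtain m where "k = Suc m" using assms(5) by (cases k) auto
  then show ?thesis
    using lower_endpoint_eq[of m] selection_event_iff[of k] assms(5,6) by simp
qed

end
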